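(* Let $C$ be a coalgebra over a field $k$. The following assertions are equivalent. (1) $C$ is a symmetric coalgebra. (2) There exists a bilinear form $B:C\times C\to k$ which is symmetric, non-degenerate and $C^*$-balanced. (3) $C$ is co-Frobenius, and there exist an injective morphism of left $C^*$-modules $\alpha:C\to C^*$ and a linear map $f:C\to k$ such that, denoting by $(C,\circ)$ the ring with local units with multiplication $x\circ y=\alpha^{-1}(\alpha(x)\alpha(y))$, we have: (i) $f(x\circ y)=f(y\circ x)$ for all $x,y\in C$; (ii) $f(c^*\cdot x)=f(x\cdot c^* )$ for all $x\in C$, $c^*\in C^*$; (iii) $\mathrm{Ker}(f)$ does not contain a non-zero left coideal of $C$. Moreover the equivalence also holds with "left coideal" replaced by "right coideal" in (iii).
   Context: For a coalgebra $C$ over $k$ with $\Delta(x)=\sum x_1\otimes x_2$, the dual $C^*$ is an algebra with the convolution product $(c^*d^* )(x)=\sum c^*(x_1)d^*(x_2)$. $C$ is a $(C^*,C^* )$-bimodule with $c^*\cdot x=\sum c^*(x_2)x_1$ and $x\cdot c^*=\sum c^*(x_1)x_2$; $C^*$ is a bimodule over itself by multiplication. No finite dimensionality is assumed. $C$ is symmetric if there exists an injective morphism $C\to C^*$ of $(C^*,C^* )$-bimodules. $C$ is left (respectively right) co-Frobenius if there is an injective morphism of left (respectively right) $C^*$-modules $C\to C^*$; co-Frobenius means left and right co-Frobenius. A bilinear form $B:C\times C\to k$ is $C^*$-balanced if $B(x\cdot c^*,y)=B(x,c^*\cdot y)$ for all $x,y\in C$, $c^*\in C^*$; non-degenerate if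 $B(C,y)=0$ implies $y=0$ and $B(y,C)=0$ implies $y=0$; symmetric if $B(x,y)=B(y,x)$ for all $x,y$. For co-Frobenius $C$, the rational parts of $C^*$ as a left and as a right $C^*$-module (the largest submodules whose structure is induced by a $C$-comodule structure) coincide and are denoted $\mathrm{Rat}(C^* )$; this is a subring of $C^*$ with local units, and any injective left $C^*$-linear map $\alpha:C\to C^*$ has image exactly $\mathrm{Rat}(C^* )$, so $\alpha^{-1}:\mathrm{Rat}(C^* )\to C$ makes sense and $(C,\circ)$ is a ring with local units (every finite subset has a two-sided idempotent unit). A left (respectively right) coideal of $C$ is a subspace $I$ with $\Delta(I)\subseteq C\otimes I$ (respectively $\Delta(I)\subseteq I\otimes C$). *)

theory Defs
  imports Complex_Main "HOL-Library.Poly_Mapping"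
begin

section \<open>Free vector spaces and tensor powers\<close>

text \<open>
  Vector spaces are given, as in \<^theory>\<open>HOL.Vector_Spaces\<close>, by a scalar multiplication
  \<open>scale :: 'k \<Rightarrow> 'c \<Rightarrow> 'c\<close> on a type.  The finitely supported functions
  \<open>'t \<Rightarrow>\<^sub>0 'k\<close> are the free vector space on \<open>'t\<close>, that is, the formal linear
  combinations of elements of \<open>'t\<close>.
\<close>

definition free_scale :: "'k::field \<Rightarrow> ('t \<Rightarrow>\<^sub>0 'k) \<Rightarrow> ('t \<Rightarrow>\<^sub>0 'k)"
  where "free_scale a p = Poly_Mapping.map ((*) a) p"

lemma lookup_free_scale [simp]: "Poly_Mapping.lookup (free_scale a p) t = a * Poly_Mapping.lookup p t"
  by (simp add: free_scale_def map.rep_eq when_def)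

global_interpretation free: vector_space free_scale
  by unfold_locales (auto intro!: poly_mapping_eqI simp: lookup_add algebra_simps)

definition free_lift :: "('k::field \<Rightarrow> 'v \<Rightarrow> 'v) \<Rightarrow> ('t \<Rightarrow> 'v::ab_group_add) \<Rightarrow> ('t \<Rightarrow>\<^sub>0 'k) \<Rightarrow> 'v"
  where "free_lift s g p = (\<Sum>t\<in>Poly_Mapping.keys p. s (Poly_Mapping.lookup p t) (g t))"

text \<open>
  The subspace of relations that force every map in \<open>slots\<close> (the embeddings of a single tensor
  factor, the other factors being fixed) to become linear.
\<close>

definition multilinear_rel ::
    "('k::field \<Rightarrow> 'c::ab_group_add \<Rightarrow> 'c) \<Rightarrow> ('c \<Rightarrow> 't) set \<Rightarrow> ('t \<Rightarrow>\<^sub>0 'k) set"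
  where "multilinear_rel scale slots = free.span
    ({Poly_Mapping.single (\<sigma> (x + y)) 1 - Poly_Mapping.single (\<sigma> x) 1 - Poly_Mapping.single (\<sigma> y) 1
        | \<sigma> x y. \<sigma> \<in> slots}
     \<union> {Poly_Mapping.single (\<sigma> (scale a x)) 1 - free_scale a (Poly_Mapping.single (\<sigma> x) 1)
        | \<sigma> a x. \<sigma> \<in> slots})"

definition slots2 :: "('c \<Rightarrow> 'c \<times> 'c) set"
  where "slots2 = {\<lambda>u. (u, y) | y. True} \<union> {\<lambda>u. (x, u) | x. True}"

definition slots3 :: "('c \<Rightarrow> 'c \<times> 'c \<times> 'c) set"
  where "slots3 = {\<lambda>u. (u, y, z) | y z. True} \<union> {\<lambda>u. (x, u, z) | x z. True} \<union> {\<lambda>u. (x, y, u) | x y. True}"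

text \<open>Equality of formal sums in \<open>C \<otimes> C\<close> and in \<open>C \<otimes> C \<otimes> C\<close>.\<close>

definition tensor2_eq ::
    "('k::field \<Rightarrow> 'c::ab_group_add \<Rightarrow> 'c) \<Rightarrow> (('c \<times> 'c \<Rightarrow>\<^sub>0 'k) \<times> ('c \<times> 'c \<Rightarrow>\<^sub>0 'k)) set"
  where "tensor2_eq scale = {(p, q). p - q \<in> multilinear_rel scale slots2}"

definition tensor3_eq ::
    "('k::field \<Rightarrow> 'c::ab_group_add \<Rightarrow> 'c) \<Rightarrow> (('c \<times> 'c \<times> 'c \<Rightarrow>\<^sub>0 'k) \<times> ('c \<times> 'c \<times> 'c \<Rightarrow>\<^sub>0 'k)) set"
  where "tensor3_eq scale = {(p, q). p - q \<in> multilinear_rel scale slots3}"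

definition tensor2 :: "('k::field \<Rightarrow> 'c::ab_group_add \<Rightarrow> 'c) \<Rightarrow> ('c \<times> 'c \<Rightarrow>\<^sub>0 'k) set set"
  where "tensor2 scale = UNIV // tensor2_eq scale"

text \<open>
  The value at \<open>T \<in> C \<otimes> C\<close> of the linear map on \<open>C \<otimes> C\<close> induced by a bilinear \<open>g\<close>, that is,
  \<open>\<Sum> g (x\<^sub>1, x\<^sub>2)\<close> for \<open>T = \<Sum> x\<^sub>1 \<otimes> x\<^sub>2\<close>.  It does not depend on the chosen representative;
  see \<open>tensor_lift_eq\<close> below.
\<close>

definition tensor_lift ::
    "('k::field \<Rightarrow> 'v \<Rightarrow> 'v) \<Rightarrow> ('c \<times> 'c \<Rightarrow> 'v::ab_group_add) \<Rightarrow> ('c \<times> 'c \<Rightarrow>\<^sub>0 'k) set \<Rightarrow> 'v"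
  where "tensor_lift s g T = free_lift s g (SOME p. p \<in> T)"

lemma free_lift_superset:
  assumes "vector_space s" "finite A" "Poly_Mapping.keys p \<subseteq> A"
  shows "free_lift s g p = (\<Sum>t\<in>A. s (Poly_Mapping.lookup p t) (g t))"
proof -
  interpret vector_space s by fact
  show ?thesis
    unfolding free_lift_def using assms(2,3)
    by (intro sum.mono_neutral_left) (auto simp: in_keys_iff)
qed

lemma linear_free_lift:
  fixes s :: "'k::field \<Rightarrow> 'v::ab_group_add \<Rightarrow> 'v" and g :: "'t \<Rightarrow> 'v"
  assumes "vector_space s"
  shows "Vector_Spaces.linear free_scale s (free_lift s g)"
proof -
  interpret vector_space s by fact
  show ?thesis
  proof
    fix p q :: "'t \<Rightarrow>\<^sub>0 'k"
    have "free_lift s g (p + q) = (\<Sum>t\<in>Poly_Mapping.keys p \<union> Poly_Mapping.keys q.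
        s (Poly_Mapping.lookup (p + q) t) (g t))"
      using assms by (intro free_lift_superset) (auto dest: subsetD[OF keys_add])
    also have "\<dots> = (\<Sum>t\<in>Poly_Mapping.keys p \<union> Poly_Mapping.keys q. s (Poly_Mapping.lookup p t) (g t))
                 + (\<Sum>t\<in>Poly_Mapping.keys p \<union> Poly_Mapping.keys q. s (Poly_Mapping.lookup q t) (g t))"
      by (simp add: lookup_add scale_left_distrib sum.distrib)
    also have "\<dots> = free_lift s g p + free_lift s g q"
      using assms by (simp add: free_lift_superset[where A = "Poly_Mapping.keys p \<union> Poly_Mapping.keys q"])
    finally show "free_lift s g (p + q) = free_lift s g p + free_lift s g q" .
  next
    fix a and p :: "'t \<Rightarrow>\<^sub>0 'k"
    have "free_lift s g (free_scale a p) = (\<Sum>t\<in>Poly_Mapping.keys p. s (Poly_Mapping.lookup (free_scale a p) t) (g t))"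
      using assms by (intro free_lift_superset) (auto simp: in_keys_iff)
    then show "free_lift s g (free_scale a p) = s a (free_lift s g p)"
      by (simp add: free_lift_def scale_sum_right)
  qed
qed

lemma free_lift_single [simp]:
  assumes "vector_space s"
  shows "free_lift s g (Poly_Mapping.single t a) = s a (g t)"
proof -
  interpret vector_space s by fact
  show ?thesis by (simp add: free_lift_def)
qed

lemma free_lift_multilinear_rel:
  assumes "vector_space s" and lin: "\<And>\<sigma>. \<sigma> \<in> slots \<Longrightarrow> Vector_Spaces.linear scale s (\<lambda>x. g (\<sigma> x))"
    and "p \<in> multilinear_rel scale slots"
  shows "free_lift s g p = 0"
proof -
  interpret vector_space s by fact
  interpret L: Vector_Spaces.linear free_scale s "free_lift s g"
    using assms(1) by (rule linear_free_lift)
  have add: "g (\<sigma> (x + y)) = g (\<sigma> x) + g (\<sigma> y)" if "\<sigma> \<in> slots" for \<sigma> x y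
    using module_hom.add[OF Vector_Spaces.linear.axioms(3)[OF lin[OF that]]] .
  have scale: "g (\<sigma> (scale a x)) = s a (g (\<sigma> x))" if "\<sigma> \<in> slots" for \<sigma> a x
    using module_hom.scale[OF Vector_Spaces.linear.axioms(3)[OF lin[OF that]]] .
  show ?thesis
    by (rule L.eq_0_on_span[OF _ assms(3)[unfolded multilinear_rel_def]])
      (auto simp: L.diff L.scale free_lift_single[OF assms(1)] add scale)
qed

lemma equiv_tensor2_eq: "equiv UNIV (tensor2_eq scale)"
proof (rule equivI)
  show "tensor2_eq scale \<subseteq> UNIV \<times> UNIV" by simp
  show "refl (tensor2_eq scale)"
    by (auto simp: refl_on_def tensor2_eq_def multilinear_rel_def free.span_zero)
  show "sym (tensor2_eq scale)"
    by (rule symI) (auto simp: tensor2_eq_def multilinear_rel_def dest: free.span_neg)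
  show "trans (tensor2_eq scale)"
    by (rule transI) (auto simp: tensor2_eq_def multilinear_rel_def dest: free.span_add)
qed

lemma tensor_lift_eq:
  assumes s: "vector_space s" and lin: "\<And>\<sigma>. \<sigma> \<in> slots2 \<Longrightarrow> Vector_Spaces.linear scale s (\<lambda>x. g (\<sigma> x))"
    and T: "T \<in> tensor2 scale" and p: "p \<in> T"
  shows "tensor_lift s g T = free_lift s g p"
proof -
  interpret L: Vector_Spaces.linear free_scale s "free_lift s g"
    using s by (rule linear_free_lift)
  define q where "q = (SOME p. p \<in> T)"
  have "q \<in> T" unfolding q_def using p by (rule someI)
  then have "(q, p) \<in> tensor2_eq scale"
    using p T[unfolded tensor2_def] quotient_eq_iff[OF equiv_tensor2_eq] by blast
  then have "free_lift s g (q - p) = 0"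
    using free_lift_multilinear_rel[OF s lin] by (auto simp: tensor2_eq_def)
  then show ?thesis by (simp add: tensor_lift_def q_def[symmetric] L.diff)
qed


section \<open>Coalgebras\<close>

text \<open>
  The two sides of coassociativity are \<open>\<Sum> (x\<^sub>1)\<^sub>1 \<otimes> (x\<^sub>1)\<^sub>2 \<otimes> x\<^sub>2\<close> and
  \<open>\<Sum> x\<^sub>1 \<otimes> (x\<^sub>2)\<^sub>1 \<otimes> (x\<^sub>2)\<^sub>2\<close>, as formal sums of triples; they are compared in
  \<open>C \<otimes> C \<otimes> C\<close>, where the chosen representatives no longer matter.
\<close>

locale coalgebra = vector_space scale
  for scale :: "'k::field \<Rightarrow> 'c::ab_group_add \<Rightarrow> 'c" +
  fixes \<Delta> :: "'c \<Rightarrow> ('c \<times> 'c \<Rightarrow>\<^sub>0 'k) set"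
    and \<epsilon> :: "'c \<Rightarrow> 'k"
  assumes comult_tensor: "\<Delta> x \<in> tensor2 scale"
    and comult_add: "p \<in> \<Delta> x \<Longrightarrow> q \<in> \<Delta> y \<Longrightarrow> p + q \<in> \<Delta> (x + y)"
    and comult_scale: "p \<in> \<Delta> x \<Longrightarrow> free_scale a p \<in> \<Delta> (scale a x)"
    and counit_linear: "Vector_Spaces.linear scale (*) \<epsilon>"
    and coassoc:
      "(tensor_lift free_scale
          (\<lambda>(x\<^sub>1, x\<^sub>2). tensor_lift free_scale (\<lambda>(u, v). Poly_Mapping.single (u, v, x\<^sub>2) 1) (\<Delta> x\<^sub>1)) (\<Delta> x),
        tensor_lift free_scale
          (\<lambda>(x\<^sub>1, x\<^sub>2). tensor_lift free_scale (\<lambda>(u, v). Poly_Mapping.single (x\<^sub>1, u, v) 1) (\<Delta> x\<^sub>2)) (\<Delta> x))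
       \<in> tensor3_eq scale"
    and counit_left: "tensor_lift scale (\<lambda>(x\<^sub>1, x\<^sub>2). scale (\<epsilon> x\<^sub>1) x\<^sub>2) (\<Delta> x) = x"
    and counit_right: "tensor_lift scale (\<lambda>(x\<^sub>1, x\<^sub>2). scale (\<epsilon> x\<^sub>2) x\<^sub>1) (\<Delta> x) = x"

definition dual :: "('k::field \<Rightarrow> 'c::ab_group_add \<Rightarrow> 'c) \<Rightarrow> ('c \<Rightarrow> 'k) set"
  where "dual scale = {c. Vector_Spaces.linear scale (*) c}"

definition convolution ::
    "('c \<Rightarrow> ('c \<times> 'c \<Rightarrow>\<^sub>0 'k::field) set) \<Rightarrow> ('c \<Rightarrow> 'k) \<Rightarrow> ('c \<Rightarrow> 'k) \<Rightarrow> 'c \<Rightarrow> 'k"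
  where "convolution \<Delta> c d = (\<lambda>x. tensor_lift (*) (\<lambda>(x\<^sub>1, x\<^sub>2). c x\<^sub>1 * d x\<^sub>2) (\<Delta> x))"

definition left_act ::
    "('k::field \<Rightarrow> 'c::ab_group_add \<Rightarrow> 'c) \<Rightarrow> ('c \<Rightarrow> ('c \<times> 'c \<Rightarrow>\<^sub>0 'k) set) \<Rightarrow> ('c \<Rightarrow> 'k) \<Rightarrow> 'c \<Rightarrow> 'c"
  where "left_act scale \<Delta> c x = tensor_lift scale (\<lambda>(x\<^sub>1, x\<^sub>2). scale (c x\<^sub>2) x\<^sub>1) (\<Delta> x)"

definition right_act ::
    "('k::field \<Rightarrow> 'c::ab_group_add \<Rightarrow> 'c) \<Rightarrow> ('c \<Rightarrow> ('c \<times> 'c \<Rightarrow>\<^sub>0 'k) set) \<Rightarrow> 'c \<Rightarrow> ('c \<Rightarrow> 'k) \<Rightarrow> 'c"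
  where "right_act scale \<Delta> x c = tensor_lift scale (\<lambda>(x\<^sub>1, x\<^sub>2). scale (c x\<^sub>1) x\<^sub>2) (\<Delta> x)"

definition linear_to_dual ::
    "('k::field \<Rightarrow> 'c::ab_group_add \<Rightarrow> 'c) \<Rightarrow> ('c \<Rightarrow> 'c \<Rightarrow> 'k) \<Rightarrow> bool"
  where "linear_to_dual scale \<alpha> \<longleftrightarrow>
    (\<forall>x. \<alpha> x \<in> dual scale) \<and>
    (\<forall>x y. \<alpha> (x + y) = (\<lambda>z. \<alpha> x z + \<alpha> y z)) \<and>
    (\<forall>a x. \<alpha> (scale a x) = (\<lambda>z. a * \<alpha> x z))"

definition left_dual_hom ::
    "('k::field \<Rightarrow> 'c::ab_group_add \<Rightarrow> 'c) \<Rightarrow> ('c \<Rightarrow> ('c \<times> 'c \<Rightarrow>\<^sub>0 'k) set) \<Rightarrow> ('c \<Rightarrow> 'c \<Rightarrow> 'k) \<Rightarrow> bool"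
  where "left_dual_hom scale \<Delta> \<alpha> \<longleftrightarrow> linear_to_dual scale \<alpha> \<and>
    (\<forall>c \<in> dual scale. \<forall>x. \<alpha> (left_act scale \<Delta> c x) = convolution \<Delta> c (\<alpha> x))"

definition right_dual_hom ::
    "('k::field \<Rightarrow> 'c::ab_group_add \<Rightarrow> 'c) \<Rightarrow> ('c \<Rightarrow> ('c \<times> 'c \<Rightarrow>\<^sub>0 'k) set) \<Rightarrow> ('c \<Rightarrow> 'c \<Rightarrow> 'k) \<Rightarrow> bool"
  where "right_dual_hom scale \<Delta> \<alpha> \<longleftrightarrow> linear_to_dual scale \<alpha> \<and>
    (\<forall>c \<in> dual scale. \<forall>x. \<alpha> (right_act scale \<Delta> x c) = convolution \<Delta> (\<alpha> x) c)"

definition symmetric_coalgebra ::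
    "('k::field \<Rightarrow> 'c::ab_group_add \<Rightarrow> 'c) \<Rightarrow> ('c \<Rightarrow> ('c \<times> 'c \<Rightarrow>\<^sub>0 'k) set) \<Rightarrow> bool"
  where "symmetric_coalgebra scale \<Delta> \<longleftrightarrow>
    (\<exists>\<alpha>. inj \<alpha> \<and> left_dual_hom scale \<Delta> \<alpha> \<and> right_dual_hom scale \<Delta> \<alpha>)"

definition left_co_Frobenius ::
    "('k::field \<Rightarrow> 'c::ab_group_add \<Rightarrow> 'c) \<Rightarrow> ('c \<Rightarrow> ('c \<times> 'c \<Rightarrow>\<^sub>0 'k) set) \<Rightarrow> bool"
  where "left_co_Frobenius scale \<Delta> \<longleftrightarrow> (\<exists>\<alpha>. inj \<alpha> \<and> left_dual_hom scale \<Delta> \<alpha>)"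

definition right_co_Frobenius ::
    "('k::field \<Rightarrow> 'c::ab_group_add \<Rightarrow> 'c) \<Rightarrow> ('c \<Rightarrow> ('c \<times> 'c \<Rightarrow>\<^sub>0 'k) set) \<Rightarrow> bool"
  where "right_co_Frobenius scale \<Delta> \<longleftrightarrow> (\<exists>\<alpha>. inj \<alpha> \<and> right_dual_hom scale \<Delta> \<alpha>)"

definition co_Frobenius ::
    "('k::field \<Rightarrow> 'c::ab_group_add \<Rightarrow> 'c) \<Rightarrow> ('c \<Rightarrow> ('c \<times> 'c \<Rightarrow>\<^sub>0 'k) set) \<Rightarrow> bool"
  where "co_Frobenius scale \<Delta> \<longleftrightarrow> left_co_Frobenius scale \<Delta> \<and> right_co_Frobenius scale \<Delta>"

definition bilinear_form ::
    "('k::field \<Rightarrow> 'c::ab_group_add \<Rightarrow> 'c) \<Rightarrow> ('c \<Rightarrow> 'c \<Rightarrow> 'k) \<Rightarrow> bool"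
  where "bilinear_form scale B \<longleftrightarrow>
    (\<forall>x. Vector_Spaces.linear scale (*) (\<lambda>y. B x y)) \<and>
    (\<forall>y. Vector_Spaces.linear scale (*) (\<lambda>x. B x y))"

definition balanced_form ::
    "('k::field \<Rightarrow> 'c::ab_group_add \<Rightarrow> 'c) \<Rightarrow> ('c \<Rightarrow> ('c \<times> 'c \<Rightarrow>\<^sub>0 'k) set) \<Rightarrow> ('c \<Rightarrow> 'c \<Rightarrow> 'k) \<Rightarrow> bool"
  where "balanced_form scale \<Delta> B \<longleftrightarrow>
    (\<forall>x y. \<forall>c \<in> dual scale. B (right_act scale \<Delta> x c) y = B x (left_act scale \<Delta> c y))"

definition nondegenerate_form :: "('c::ab_group_add \<Rightarrow> 'c \<Rightarrow> 'k::field) \<Rightarrow> bool"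
  where "nondegenerate_form B \<longleftrightarrow>
    (\<forall>y. (\<forall>x. B x y = 0) \<longrightarrow> y = 0) \<and> (\<forall>y. (\<forall>x. B y x = 0) \<longrightarrow> y = 0)"

definition symmetric_form :: "('c \<Rightarrow> 'c \<Rightarrow> 'k) \<Rightarrow> bool"
  where "symmetric_form B \<longleftrightarrow> (\<forall>x y. B x y = B y x)"

text \<open>
  \<open>x \<circ> y = \<alpha>\<^sup>-\<^sup>1 (\<alpha> x \<alpha> y)\<close>.  For an injective left module morphism \<open>\<alpha>\<close> the product
  \<open>\<alpha> x \<alpha> y\<close> lies in the image of \<open>\<alpha>\<close> (see \<open>convolution_in_range\<close>), so that
  \<^term>\<open>inv \<alpha>\<close> is the honest inverse there.
\<close>

definition circ ::
    "('c \<Rightarrow> ('c \<times> 'c \<Rightarrow>\<^sub>0 'k::field) set) \<Rightarrow> ('c \<Rightarrow> 'c \<Rightarrow> 'k) \<Rightarrow> 'c \<Rightarrow> 'c \<Rightarrow> 'c"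
  where "circ \<Delta> \<alpha> x y = inv \<alpha> (convolution \<Delta> (\<alpha> x) (\<alpha> y))"

lemma convolution_in_range:
  assumes "left_dual_hom scale \<Delta> \<alpha>"
  shows "convolution \<Delta> (\<alpha> x) (\<alpha> y) \<in> range \<alpha>"
proof -
  have "convolution \<Delta> (\<alpha> x) (\<alpha> y) = \<alpha> (left_act scale \<Delta> (\<alpha> x) y)"
    using assms by (simp add: left_dual_hom_def linear_to_dual_def)
  then show ?thesis by simp
qed

text \<open>
  \<open>\<Delta> x \<in> C \<otimes> I\<close> means that the tensor \<open>\<Delta> x\<close> is represented by some formal sum of pairs whose
  second entries lie in \<open>I\<close>.
\<close>

definition left_coideal ::
    "('k::field \<Rightarrow> 'c::ab_group_add \<Rightarrow> 'c) \<Rightarrow> ('c \<Rightarrow> ('c \<times> 'c \<Rightarrow>\<^sub>0 'k) set) \<Rightarrow> 'c set \<Rightarrow> bool"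
  where "left_coideal scale \<Delta> I \<longleftrightarrow>
    module.subspace scale I \<and> (\<forall>x\<in>I. \<exists>p\<in>\<Delta> x. Poly_Mapping.keys p \<subseteq> UNIV \<times> I)"

definition right_coideal ::
    "('k::field \<Rightarrow> 'c::ab_group_add \<Rightarrow> 'c) \<Rightarrow> ('c \<Rightarrow> ('c \<times> 'c \<Rightarrow>\<^sub>0 'k) set) \<Rightarrow> 'c set \<Rightarrow> bool"
  where "right_coideal scale \<Delta> I \<longleftrightarrow>
    module.subspace scale I \<and> (\<forall>x\<in>I. \<exists>p\<in>\<Delta> x. Poly_Mapping.keys p \<subseteq> I \<times> UNIV)"

end

theory Submission
  imports Defs
begin

text \<open>
  Write \<open>c \<rightharpoonup> x\<close> and \<open>x \<leftharpoonup> c\<close> for the two actions of the dual algebra, and \<open>\<star>\<close> for convolution.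
  Everything is compared with a bilinear form: \<open>B x y = \<alpha> x y\<close> for a bimodule morphism \<open>\<alpha>\<close>, and
  \<open>B x y = f (\<alpha> x \<rightharpoonup> y)\<close> for a trace \<open>f\<close>.  What has to be explained is the symmetry of the former
  and the non-degeneracy of the latter.

  Symmetry.  If \<open>\<alpha>\<close> is a bimodule morphism, then \<open>\<alpha> (\<alpha> x \<rightharpoonup> y) = \<alpha> x \<star> \<alpha> y = \<alpha> (x \<leftharpoonup> \<alpha> y)\<close>, so by
  injectivity \<open>\<alpha> x \<rightharpoonup> y = x \<leftharpoonup> \<alpha> y\<close>; the counit turns this into \<open>\<alpha> x y = \<alpha> y x\<close>
  (\<open>bimodule_hom_symmetric\<close>).  Balancedness of \<open>B\<close> is right linearity of \<open>\<alpha>\<close>, and for a symmetric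
  form it implies left linearity as well.

  From a symmetric coalgebra to a trace.  Since \<open>x \<circ> y = \<alpha> x \<rightharpoonup> y\<close>, the counit \<open>f = \<epsilon>\<close> gives
  \<open>f (x \<circ> y) = \<alpha> x y\<close>, which is symmetric; and \<open>\<epsilon> (c \<rightharpoonup> x) = c x = \<epsilon> (x \<leftharpoonup> c)\<close>.  A one-sided coideal
  in the kernel of \<open>\<epsilon>\<close> is zero by the counit axiom.

  From a trace to a symmetric coalgebra (\<open>symmetric_coalgebraI_trace\<close>).  The form
  \<open>B x y = f (x \<circ> y) = f (\<alpha> x \<rightharpoonup> y)\<close> is symmetric by the trace property on \<open>\<circ>\<close>, and balanced by
  the trace property on the actions.  The delicate point is non-degeneracy.  By
  definition of the radical \<open>J\<close> of \<open>B\<close>, the trace \<open>f\<close> vanishes on the products \<open>x \<circ> y\<close> with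
  \<open>x \<in> J\<close>, and coideals can be formed from such products: for \<open>x \<in> J\<close> the kernel of \<open>f\<close>
  contains the left coideal \<open>{\<alpha> x \<rightharpoonup> y | y}\<close> and, for fixed \<open>y\<close>, the right coideal \<open>{\<alpha> x' \<rightharpoonup> y | x' \<in> J}\<close>.  Either version of the hypothesis on
  \<open>f\<close> thus gives \<open>\<alpha> x \<rightharpoonup> y = 0\<close> for all \<open>y\<close>; the counit yields \<open>\<alpha> x = 0\<close> and hence \<open>x = 0\<close>.

  The remaining work is the passage from submodules to coideals (\<open>left_coidealI\<close>,
  \<open>right_coidealI\<close>): expanding one tensor factor of \<open>\<Delta> x\<close> in a basis, the coefficients in the
  other factor are \<open>x \<leftharpoonup> c\<close>, respectively \<open>c \<rightharpoonup> x\<close>, for the coordinate functionals \<open>c\<close>.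
\<close>

section \<open>Tensors as linear combinations over a basis\<close>

lemma scalar_vector_space: "vector_space ((*) :: 'k::field \<Rightarrow> 'k \<Rightarrow> 'k)"
  by unfold_locales (auto simp: algebra_simps)

lemma linear_free_lift_commute:
  assumes "Vector_Spaces.linear s s' h"
  shows "h (free_lift s g p) = free_lift s' (\<lambda>t. h (g t)) p"
proof -
  interpret Vector_Spaces.linear s s' h by fact
  show ?thesis by (simp add: free_lift_def sum scale)
qed

text \<open>
  The representative of \<open>T\<close> is chosen before \<open>g\<close> and \<open>h\<close> are applied, so the identity holds
  for an arbitrary function \<open>g\<close>.  This matters for coassociativity, where \<open>g\<close> takes values in formal
  sums and becomes bilinear only modulo the tensor relations.
\<close>

lemma linear_tensor_lift_commute:
  assumes "Vector_Spaces.linear s s' h"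
  shows "h (tensor_lift s g T) = tensor_lift s' (\<lambda>t. h (g t)) T"
  unfolding tensor_lift_def using assms by (rule linear_free_lift_commute)

lemma tensor_lift_add:
  assumes "vector_space s"
  shows "tensor_lift s (\<lambda>t. g t + h t) T = tensor_lift s g T + tensor_lift s h T"
proof -
  interpret vector_space s by fact
  show ?thesis by (simp add: tensor_lift_def free_lift_def scale_right_distrib sum.distrib)
qed

lemma tensor_lift_scale:
  assumes "vector_space s"
  shows "tensor_lift s (\<lambda>t. s a (g t)) T = s a (tensor_lift s g T)"
proof -
  interpret vector_space s by fact
  show ?thesis
    by (simp add: tensor_lift_def free_lift_def scale_sum_right mult.commute)
qed

lemma subspace_multilinear_rel: "free.subspace (multilinear_rel scale slots)"
  unfolding multilinear_rel_def by (rule free.subspace_span)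

text \<open>
  By its two kinds of generators, the relation subspace makes every slot additive and homogeneous;
  induction extends this to finite linear combinations.
\<close>

lemma multilinear_rel_slot_sum:
  fixes scale :: "'k::field \<Rightarrow> 'c::ab_group_add \<Rightarrow> 'c"
  assumes "vector_space scale" and \<sigma>: "\<sigma> \<in> slots" and "finite A"
  shows "Poly_Mapping.single (\<sigma> (\<Sum>i\<in>A. scale (a i) (w i))) 1
    - (\<Sum>i\<in>A. free_scale (a i) (Poly_Mapping.single (\<sigma> (w i)) 1)) \<in> multilinear_rel scale slots"
    (is "?D A \<in> _")
proof -
  interpret vector_space scale by fact
  note subspace = subspace_multilinear_rel[of scale slots]
  have add: "Poly_Mapping.single (\<sigma> (x + y)) 1 - Poly_Mapping.single (\<sigma> x) 1
      - Poly_Mapping.single (\<sigma> y) 1 \<in> multilinear_rel scale slots" for x y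
    unfolding multilinear_rel_def using \<sigma> by (intro free.span_base) blast
  have scl: "Poly_Mapping.single (\<sigma> (scale b x)) 1 - free_scale b (Poly_Mapping.single (\<sigma> x) 1)
      \<in> multilinear_rel scale slots" for b x
    unfolding multilinear_rel_def using \<sigma> by (intro free.span_base) blast
  from \<open>finite A\<close> show ?thesis
  proof induction
    case empty
    have "- (Poly_Mapping.single (\<sigma> (0 + 0)) 1 - Poly_Mapping.single (\<sigma> 0) 1
      - Poly_Mapping.single (\<sigma> 0) (1::'k)) \<in> multilinear_rel scale slots"
      by (intro free.subspace_neg subspace add)
    then show ?case by simp
  next
    case (insert i A)
    let ?x = "scale (a i) (w i)" and ?y = "\<Sum>i\<in>A. scale (a i) (w i)"
    have "(Poly_Mapping.single (\<sigma> (?x + ?y)) 1 - Poly_Mapping.single (\<sigma> ?x) 1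
        - Poly_Mapping.single (\<sigma> ?y) 1)
      + (Poly_Mapping.single (\<sigma> ?x) 1 - free_scale (a i) (Poly_Mapping.single (\<sigma> (w i)) 1))
      + ?D A \<in> multilinear_rel scale slots"
      by (intro free.subspace_add subspace add scl insert.IH)
    then show ?case using insert.hyps by (simp add: algebra_simps)
  qed
qed

text \<open>
  Expanding one factor of every elementary tensor in a fixed basis \<open>B\<close> and collecting the terms
  with equal basis vector rewrites a tensor as \<open>\<Sum> b \<otimes> v\<^sub>b\<close>.  The point is that \<open>v\<^sub>b\<close> is the
  contraction of the tensor with the coordinate functional of \<open>b\<close>.  The pairing \<open>\<tau>\<close> is
  \<open>(b, v)\<close> or \<open>(v, b)\<close>, according to which factor is expanded.
\<close>

lemma tensor2_basis_expansion:
  fixes scale :: "'k::field \<Rightarrow> 'c::ab_group_add \<Rightarrow> 'c" and p :: "'c \<times> 'c \<Rightarrow>\<^sub>0 'k"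
  assumes "vector_space scale"
    and g_slot: "\<And>y. (\<lambda>u. \<tau> u y) \<in> slots2" and h_slot: "\<And>x. \<tau> x \<in> slots2"
    and \<tau>: "\<And>t. \<tau> (g t) (h t) = t"
  obtains S rep where "finite S" and "\<And>b. rep b \<in> dual scale"
    and "p - (\<Sum>b\<in>S. Poly_Mapping.single (\<tau> b (free_lift scale (\<lambda>t. scale (rep b (g t)) (h t)) p)) 1)
      \<in> multilinear_rel scale slots2"
proof -
  interpret vector_space scale by fact
  let ?M = "multilinear_rel scale slots2"
  define B where "B = extend_basis {}"
  have B: "independent B" "span B = UNIV"
    using independent_extend_basis[OF independent_empty] span_extend_basis[OF independent_empty]
    by (simp_all add: B_def)
  define rep where "rep b u = representation B u b" for b u
  have rep: "rep b \<in> dual scale" for b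
    using linear_representation[OF B, of b] by (simp add: dual_def rep_def [abs_def])
  define K where "K = Poly_Mapping.keys p"
  \<comment> \<open>The basis may be infinite, but only finitely many coordinates occur in \<open>p\<close>.\<close>
  define S where "S = (\<Union>t\<in>K. {b. rep b (g t) \<noteq> 0})"
  have "finite S"
    unfolding S_def rep_def K_def by (intro finite_UN_I finite_keys finite_representation)
  define single' where "single' t = Poly_Mapping.single t (1::'k)" for t :: "'c \<times> 'c"
  define l where "l t = Poly_Mapping.lookup p t" for t
  have expand_p: "p = (\<Sum>t\<in>K. free_scale (l t) (single' t))"
    by (rule poly_mapping_eqI)
      (auto simp: lookup_sum single'_def K_def l_def lookup_single when_def in_keys_iff
        if_distrib[where f = "(*) _"] sum.delta cong: if_cong)
  have expand_g: "single' t - (\<Sum>b\<in>S. free_scale (rep b (g t)) (single' (\<tau> b (h t)))) \<in> ?M"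
    if "t \<in> K" for t
  proof -
    have "(\<Sum>b\<in>S. scale (rep b (g t)) b) = g t"
      using sum_nonzero_representation_eq[of B "g t"] B \<open>finite S\<close> that
      by (subst sum.mono_neutral_right[of S "{b. rep b (g t) \<noteq> 0}"]) (auto simp: S_def rep_def)
    then show ?thesis
      using multilinear_rel_slot_sum[OF \<open>vector_space scale\<close> g_slot[of "h t"] \<open>finite S\<close>,
          where a = "\<lambda>b. rep b (g t)" and w = "\<lambda>b. b"]
      by (simp add: single'_def \<tau>)
  qed
  have collect_h: "single' (\<tau> b (free_lift scale (\<lambda>t. scale (rep b (g t)) (h t)) p))
      - (\<Sum>t\<in>K. free_scale (l t * rep b (g t)) (single' (\<tau> b (h t)))) \<in> ?M" for b
    using multilinear_rel_slot_sum[OF \<open>vector_space scale\<close> h_slot, of K b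
        "\<lambda>t. l t * rep b (g t)" h]
    by (simp add: single'_def free_lift_def K_def l_def)
  let ?q = "\<Sum>b\<in>S. single' (\<tau> b (free_lift scale (\<lambda>t. scale (rep b (g t)) (h t)) p))"
  have "(\<Sum>t\<in>K. free_scale (l t) (single' t
        - (\<Sum>b\<in>S. free_scale (rep b (g t)) (single' (\<tau> b (h t))))))
      - (\<Sum>b\<in>S. single' (\<tau> b (free_lift scale (\<lambda>t. scale (rep b (g t)) (h t)) p))
        - (\<Sum>t\<in>K. free_scale (l t * rep b (g t)) (single' (\<tau> b (h t))))) \<in> ?M"
    by (intro free.subspace_diff free.subspace_sum free.subspace_scale
        subspace_multilinear_rel expand_g collect_h)
  also have "(\<Sum>t\<in>K. free_scale (l t) (single' t
        - (\<Sum>b\<in>S. free_scale (rep b (g t)) (single' (\<tau> b (h t)))))) =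
      p - (\<Sum>b\<in>S. \<Sum>t\<in>K. free_scale (l t * rep b (g t)) (single' (\<tau> b (h t))))"
    by (subst sum.swap)
      (simp add: free.scale_right_diff_distrib sum_subtractf free.scale_sum_right
        flip: expand_p)
  finally have "p - ?q \<in> ?M"
    by (simp add: sum_subtractf)
  with \<open>finite S\<close> rep show thesis
    using that unfolding single'_def by blast
qed


section \<open>Calculus of the two actions\<close>

context coalgebra
begin

text \<open>
  The form in which coassociativity is used: a trilinear map \<open>G\<close> kills the relations of the
  threefold tensor product, so it takes the same value on the two iterated comultiplications.
\<close>

lemma coassoc_lift:
  assumes "vector_space s"
    and "\<And>y z. Vector_Spaces.linear scale s (\<lambda>u. G (u, y, z))"
    and "\<And>x z. Vector_Spaces.linear scale s (\<lambda>u. G (x, u, z))"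
    and "\<And>x y. Vector_Spaces.linear scale s (\<lambda>u. G (x, y, u))"
  shows "tensor_lift s (\<lambda>(x\<^sub>1, x\<^sub>2). tensor_lift s (\<lambda>(u, v). G (u, v, x\<^sub>2)) (\<Delta> x\<^sub>1)) (\<Delta> x) =
    tensor_lift s (\<lambda>(x\<^sub>1, x\<^sub>2). tensor_lift s (\<lambda>(u, v). G (x\<^sub>1, u, v)) (\<Delta> x\<^sub>2)) (\<Delta> x)"
proof -
  note L = linear_free_lift[OF assms(1), of G]
  interpret L: Vector_Spaces.linear free_scale s "free_lift s G" by fact
  interpret s: vector_space s by fact
  from coassoc[of x] have "free_lift s G
     (tensor_lift free_scale
          (\<lambda>(x\<^sub>1, x\<^sub>2). tensor_lift free_scale (\<lambda>(u, v). Poly_Mapping.single (u, v, x\<^sub>2) 1) (\<Delta> x\<^sub>1)) (\<Delta> x) -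
        tensor_lift free_scale
          (\<lambda>(x\<^sub>1, x\<^sub>2). tensor_lift free_scale (\<lambda>(u, v). Poly_Mapping.single (x\<^sub>1, u, v) 1) (\<Delta> x\<^sub>2)) (\<Delta> x)) = 0"
    unfolding tensor3_eq_def using assms
    by (intro free_lift_multilinear_rel[where scale = scale and slots = slots3])
      (auto simp: slots3_def)
  then show ?thesis
    by (simp add: L.diff linear_tensor_lift_commute[OF L] case_prod_unfold
        free_lift_single[OF assms(1)])
qed

lemma comult_nonempty: "\<exists>p. p \<in> \<Delta> x"
  using in_quotient_imp_non_empty[OF equiv_tensor2_eq] comult_tensor[of x]
  unfolding tensor2_def by blast

text \<open>
  For bilinear \<open>g\<close> the value may be computed from any representative, in particular from the sums
  and multiples of representatives that lie in \<open>\<Delta> (x + y)\<close> and \<open>\<Delta> (scale a x)\<close>.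
\<close>

lemma linear_tensor_lift_comult:
  assumes "vector_space s"
    and "\<And>y. Vector_Spaces.linear scale s (\<lambda>u. g (u, y))"
    and "\<And>x. Vector_Spaces.linear scale s (\<lambda>u. g (x, u))"
  shows "Vector_Spaces.linear scale s (\<lambda>x. tensor_lift s g (\<Delta> x))"
proof -
  interpret L: Vector_Spaces.linear free_scale s "free_lift s g"
    using assms(1) by (rule linear_free_lift)
  have eq: "tensor_lift s g (\<Delta> x) = free_lift s g p" if "p \<in> \<Delta> x" for x p
    using assms(2,3) that
    by (intro tensor_lift_eq[OF assms(1) _ comult_tensor]) (auto simp: slots2_def)
  show ?thesis
    unfolding Vector_Spaces.linear_iff
  proof (intro conjI allI)
    fix x y
    obtain p q where "p \<in> \<Delta> x" "q \<in> \<Delta> y" using comult_nonempty by blast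
    then show "tensor_lift s g (\<Delta> (x + y)) = tensor_lift s g (\<Delta> x) + tensor_lift s g (\<Delta> y)"
      using eq[OF comult_add] by (simp add: eq L.add)
  next
    fix a x
    obtain p where "p \<in> \<Delta> x" using comult_nonempty by blast
    then show "tensor_lift s g (\<Delta> (scale a x)) = s a (tensor_lift s g (\<Delta> x))"
      using eq[OF comult_scale] by (simp add: eq L.scale)
  qed (rule vector_space_axioms assms(1))+
qed

lemma dual_linear: "c \<in> dual scale \<Longrightarrow> Vector_Spaces.linear scale (*) c"
  by (simp add: dual_def)

lemma dual_add: "c \<in> dual scale \<Longrightarrow> c (x + y) = c x + c y"
  and dual_scale: "c \<in> dual scale \<Longrightarrow> c (scale a x) = a * c x"
  by (simp_all add: dual_def Vector_Spaces.linear_iff)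

lemma dual_zero: "c \<in> dual scale \<Longrightarrow> c 0 = 0"
  using dual_scale[of c 0 0] by simp

lemma counit_dual: "\<epsilon> \<in> dual scale"
  using counit_linear by (simp add: dual_def)

abbreviation lact (infixr "\<rightharpoonup>" 75) where "c \<rightharpoonup> x \<equiv> left_act scale \<Delta> c x"
abbreviation ract (infixl "\<leftharpoonup>" 75) where "x \<leftharpoonup> c \<equiv> right_act scale \<Delta> x c"
abbreviation conv (infixl "\<star>" 75) where "c \<star> d \<equiv> convolution \<Delta> c d"

lemma linear_left_act: "c \<in> dual scale \<Longrightarrow> Vector_Spaces.linear scale scale (\<lambda>x. c \<rightharpoonup> x)"
  unfolding left_act_def
  by (intro linear_tensor_lift_comult)
    (auto simp: Vector_Spaces.linear_iff vector_space_axioms dual_add dual_scale algebra_simps)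

lemma linear_right_act: "c \<in> dual scale \<Longrightarrow> Vector_Spaces.linear scale scale (\<lambda>x. x \<leftharpoonup> c)"
  unfolding right_act_def
  by (intro linear_tensor_lift_comult)
    (auto simp: Vector_Spaces.linear_iff vector_space_axioms dual_add dual_scale algebra_simps)

lemma left_act_scale: "c \<in> dual scale \<Longrightarrow> c \<rightharpoonup> scale a x = scale a (c \<rightharpoonup> x)"
  and right_act_scale: "c \<in> dual scale \<Longrightarrow> scale a x \<leftharpoonup> c = scale a (x \<leftharpoonup> c)"
  using linear_left_act linear_right_act by (auto simp: Vector_Spaces.linear_iff)

lemma left_act_add_dual: "(\<lambda>z. c z + d z) \<rightharpoonup> x = (c \<rightharpoonup> x) + (d \<rightharpoonup> x)"
  by (simp add: left_act_def case_prod_unfold scale_left_distrib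
      flip: tensor_lift_add[OF vector_space_axioms])

lemma left_act_scale_dual: "(\<lambda>z. a * c z) \<rightharpoonup> x = scale a (c \<rightharpoonup> x)"
  by (simp add: left_act_def case_prod_unfold
      flip: tensor_lift_scale[OF vector_space_axioms])

text \<open>
  This and the next lemma express a convolution as an evaluation after an action; they
  translate linearity of a map into the dual into invariance of the associated form.
\<close>

lemma dual_left_act:
  assumes "c \<in> dual scale"
  shows "c (d \<rightharpoonup> x) = (c \<star> d) x"
  unfolding left_act_def convolution_def linear_tensor_lift_commute[OF dual_linear[OF assms]]
  by (simp add: case_prod_unfold dual_scale[OF assms] mult.commute)

lemma dual_right_act:
  assumes "d \<in> dual scale"
  shows "d (x \<leftharpoonup> c) = (c \<star> d) x"
  unfolding right_act_def convolution_def linear_tensor_lift_commute[OF dual_linear[OF assms]]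
  by (simp add: case_prod_unfold dual_scale[OF assms])

lemma counit_left_act: "c \<in> dual scale \<Longrightarrow> \<epsilon> (c \<rightharpoonup> x) = c x"
  using linear_tensor_lift_commute[OF dual_linear, of c "\<lambda>(x\<^sub>1, x\<^sub>2). scale (\<epsilon> x\<^sub>1) x\<^sub>2" "\<Delta> x"]
  unfolding left_act_def linear_tensor_lift_commute[OF counit_linear]
  by (simp add: case_prod_unfold dual_scale counit_dual mult.commute
      counit_left[unfolded case_prod_unfold])

lemma counit_right_act: "c \<in> dual scale \<Longrightarrow> \<epsilon> (x \<leftharpoonup> c) = c x"
  using linear_tensor_lift_commute[OF dual_linear, of c "\<lambda>(x\<^sub>1, x\<^sub>2). scale (\<epsilon> x\<^sub>2) x\<^sub>1" "\<Delta> x"]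
  unfolding right_act_def linear_tensor_lift_commute[OF counit_linear]
  by (simp add: case_prod_unfold dual_scale counit_dual mult.commute
      counit_right[unfolded case_prod_unfold])

text \<open>
  Both sides are \<open>\<Sum> c(x\<^sub>2) d(x\<^sub>3) x\<^sub>1\<close>.
\<close>

lemma left_act_convolution:
  assumes c: "c \<in> dual scale" and d: "d \<in> dual scale"
  shows "(c \<star> d) \<rightharpoonup> x = c \<rightharpoonup> (d \<rightharpoonup> x)"
proof -
  let ?G = "\<lambda>(u, v, w). scale (c v * d w) u"
  have scale_sum: "scale (tensor_lift (*) h T) u = tensor_lift scale (\<lambda>t. scale (h t) u) T" for h T u
    by (rule linear_tensor_lift_commute)
      (auto simp: Vector_Spaces.linear_iff scalar_vector_space vector_space_axioms algebra_simps)
  have "c \<rightharpoonup> (d \<rightharpoonup> x) = tensor_lift scale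
      (\<lambda>(x\<^sub>1, x\<^sub>2). tensor_lift scale (\<lambda>(u, v). ?G (u, v, x\<^sub>2)) (\<Delta> x\<^sub>1)) (\<Delta> x)"
    unfolding left_act_def[of scale \<Delta> d x] linear_tensor_lift_commute[OF linear_left_act[OF c]]
    by (simp add: case_prod_unfold left_act_scale[OF c])
      (simp add: left_act_def case_prod_unfold mult.commute
        flip: tensor_lift_scale[OF vector_space_axioms])
  also have "\<dots> = tensor_lift scale
      (\<lambda>(x\<^sub>1, x\<^sub>2). tensor_lift scale (\<lambda>(u, v). ?G (x\<^sub>1, u, v)) (\<Delta> x\<^sub>2)) (\<Delta> x)"
    using c d by (intro coassoc_lift)
      (auto simp: Vector_Spaces.linear_iff vector_space_axioms dual_add dual_scale algebra_simps)
  also have "\<dots> = (c \<star> d) \<rightharpoonup> x"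
    by (simp add: left_act_def convolution_def scale_sum case_prod_unfold)
  finally show ?thesis ..
qed

text \<open>
  Both sides are \<open>\<Sum> d(x\<^sub>1) c(x\<^sub>3) x\<^sub>2\<close>.
\<close>

lemma left_act_right_act:
  assumes c: "c \<in> dual scale" and d: "d \<in> dual scale"
  shows "(c \<rightharpoonup> x) \<leftharpoonup> d = c \<rightharpoonup> (x \<leftharpoonup> d)"
proof -
  let ?G = "\<lambda>(u, v, w). scale (d u * c w) v"
  have "(c \<rightharpoonup> x) \<leftharpoonup> d = tensor_lift scale
      (\<lambda>(x\<^sub>1, x\<^sub>2). tensor_lift scale (\<lambda>(u, v). ?G (u, v, x\<^sub>2)) (\<Delta> x\<^sub>1)) (\<Delta> x)"
    unfolding left_act_def[of scale \<Delta> c x] linear_tensor_lift_commute[OF linear_right_act[OF d]]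
    by (simp add: case_prod_unfold right_act_scale[OF d])
      (simp add: right_act_def case_prod_unfold mult.commute
        flip: tensor_lift_scale[OF vector_space_axioms])
  also have "\<dots> = tensor_lift scale
      (\<lambda>(x\<^sub>1, x\<^sub>2). tensor_lift scale (\<lambda>(u, v). ?G (x\<^sub>1, u, v)) (\<Delta> x\<^sub>2)) (\<Delta> x)"
    using c d by (intro coassoc_lift)
      (auto simp: Vector_Spaces.linear_iff vector_space_axioms dual_add dual_scale algebra_simps)
  also have "\<dots> = c \<rightharpoonup> (x \<leftharpoonup> d)"
    unfolding right_act_def[of scale \<Delta> x d] linear_tensor_lift_commute[OF linear_left_act[OF c]]
    by (simp add: case_prod_unfold left_act_scale[OF c])
      (simp add: left_act_def case_prod_unfold
        flip: tensor_lift_scale[OF vector_space_axioms])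
  finally show ?thesis .
qed


section \<open>Coideals and submodules\<close>

lemma comult_cong:
  assumes "p \<in> \<Delta> x" and "p - q \<in> multilinear_rel scale slots2"
  shows "q \<in> \<Delta> x"
  using in_quotient_imp_closed[OF equiv_tensor2_eq comult_tensor[unfolded tensor2_def] assms(1)]
    assms(2) by (simp add: tensor2_eq_def)

text \<open>
  A right submodule is a left coideal: in the expansion \<open>\<Delta> x = \<Sum> b \<otimes> v\<^sub>b\<close> over a basis of the
  first factor, \<open>v\<^sub>b = x \<leftharpoonup> c\<close> for the coordinate functional \<open>c\<close> of \<open>b\<close>, so \<open>v\<^sub>b\<close> stays in \<open>I\<close>.
\<close>

lemma left_coidealI:
  assumes "subspace I" and closed: "\<And>x c. x \<in> I \<Longrightarrow> c \<in> dual scale \<Longrightarrow> x \<leftharpoonup> c \<in> I"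
  shows "left_coideal scale \<Delta> I"
  unfolding left_coideal_def
proof (intro conjI ballI)
  fix x assume "x \<in> I"
  obtain p where p: "p \<in> \<Delta> x" using comult_nonempty by blast
  obtain S rep where "finite S" and rep: "\<And>b. rep b \<in> dual scale"
    and q: "p - (\<Sum>b\<in>S. Poly_Mapping.single
        (Pair b (free_lift scale (\<lambda>t. scale (rep b (fst t)) (snd t)) p)) 1)
      \<in> multilinear_rel scale slots2"
    by (rule tensor2_basis_expansion[OF vector_space_axioms, of Pair fst snd p])
      (auto simp: slots2_def)
  have act: "free_lift scale (\<lambda>t. scale (rep b (fst t)) (snd t)) p = x \<leftharpoonup> rep b" for b
    unfolding right_act_def case_prod_unfold using p rep[of b]
    by (intro tensor_lift_eq[OF vector_space_axioms _ comult_tensor, symmetric])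
      (auto simp: slots2_def Vector_Spaces.linear_iff vector_space_axioms dual_add dual_scale
        algebra_simps)
  show "\<exists>p\<in>\<Delta> x. Poly_Mapping.keys p \<subseteq> UNIV \<times> I"
  proof (rule bexI)
    show "(\<Sum>b\<in>S. Poly_Mapping.single (Pair b (x \<leftharpoonup> rep b)) 1) \<in> \<Delta> x"
      using comult_cong[OF p q] by (simp add: act)
    show "Poly_Mapping.keys (\<Sum>b\<in>S. Poly_Mapping.single (Pair b (x \<leftharpoonup> rep b)) (1::'k)) \<subseteq> UNIV \<times> I"
      using closed[OF \<open>x \<in> I\<close> rep] by (intro order.trans[OF keys_sum]) auto
  qed
qed fact

lemma right_coidealI:
  assumes "subspace I" and closed: "\<And>x c. x \<in> I \<Longrightarrow> c \<in> dual scale \<Longrightarrow> c \<rightharpoonup> x \<in> I"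
  shows "right_coideal scale \<Delta> I"
  unfolding right_coideal_def
proof (intro conjI ballI)
  fix x assume "x \<in> I"
  obtain p where p: "p \<in> \<Delta> x" using comult_nonempty by blast
  obtain S rep where "finite S" and rep: "\<And>b. rep b \<in> dual scale"
    and q: "p - (\<Sum>b\<in>S. Poly_Mapping.single
        (free_lift scale (\<lambda>t. scale (rep b (snd t)) (fst t)) p, b) 1)
      \<in> multilinear_rel scale slots2"
    by (rule tensor2_basis_expansion[OF vector_space_axioms, of "\<lambda>b v. (v, b)" snd fst p])
      (auto simp: slots2_def)
  have act: "free_lift scale (\<lambda>t. scale (rep b (snd t)) (fst t)) p = rep b \<rightharpoonup> x" for b
    unfolding left_act_def case_prod_unfold using p rep[of b]
    by (intro tensor_lift_eq[OF vector_space_axioms _ comult_tensor, symmetric])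
      (auto simp: slots2_def Vector_Spaces.linear_iff vector_space_axioms dual_add dual_scale
        algebra_simps)
  show "\<exists>p\<in>\<Delta> x. Poly_Mapping.keys p \<subseteq> I \<times> UNIV"
  proof (rule bexI)
    show "(\<Sum>b\<in>S. Poly_Mapping.single (rep b \<rightharpoonup> x, b) 1) \<in> \<Delta> x"
      using comult_cong[OF p q] by (simp add: act)
    show "Poly_Mapping.keys (\<Sum>b\<in>S. Poly_Mapping.single (rep b \<rightharpoonup> x, b) (1::'k)) \<subseteq> I \<times> UNIV"
      using closed[OF \<open>x \<in> I\<close> rep] by (intro order.trans[OF keys_sum]) auto
  qed
qed fact

text \<open>
  If the second entries of \<open>\<Delta> x\<close> can be chosen in the kernel of \<open>\<epsilon>\<close>, then
  \<open>x = \<Sum> \<epsilon>(x\<^sub>2) x\<^sub>1\<close> vanishes.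
\<close>

lemma left_coideal_counit_zero:
  assumes I: "left_coideal scale \<Delta> I" and "I \<subseteq> {x. \<epsilon> x = 0}"
  shows "I = {0}"
proof -
  have "x = 0" if "x \<in> I" for x
  proof -
    obtain p where p: "p \<in> \<Delta> x" "Poly_Mapping.keys p \<subseteq> UNIV \<times> I"
      using I \<open>x \<in> I\<close> by (auto simp: left_coideal_def)
    have "x = free_lift scale (\<lambda>(x\<^sub>1, x\<^sub>2). scale (\<epsilon> x\<^sub>2) x\<^sub>1) p"
      using p(1) counit_dual
      by (subst counit_right[symmetric], intro tensor_lift_eq[OF vector_space_axioms _ comult_tensor])
        (auto simp: slots2_def Vector_Spaces.linear_iff vector_space_axioms dual_add dual_scale
          algebra_simps)
    also have "\<dots> = 0"
      unfolding free_lift_def using p(2) assms(2) by (intro sum.neutral) fastforce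
    finally show ?thesis .
  qed
  then show ?thesis
    using I subspace_0 by (auto simp: left_coideal_def)
qed

lemma right_coideal_counit_zero:
  assumes I: "right_coideal scale \<Delta> I" and "I \<subseteq> {x. \<epsilon> x = 0}"
  shows "I = {0}"
proof -
  have "x = 0" if "x \<in> I" for x
  proof -
    obtain p where p: "p \<in> \<Delta> x" "Poly_Mapping.keys p \<subseteq> I \<times> UNIV"
      using I \<open>x \<in> I\<close> by (auto simp: right_coideal_def)
    have "x = free_lift scale (\<lambda>(x\<^sub>1, x\<^sub>2). scale (\<epsilon> x\<^sub>1) x\<^sub>2) p"
      using p(1) counit_dual
      by (subst counit_left[symmetric], intro tensor_lift_eq[OF vector_space_axioms _ comult_tensor])
        (auto simp: slots2_def Vector_Spaces.linear_iff vector_space_axioms dual_add dual_scale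
          algebra_simps)
    also have "\<dots> = 0"
      unfolding free_lift_def using p(2) assms(2) by (intro sum.neutral) fastforce
    finally show ?thesis .
  qed
  then show ?thesis
    using I subspace_0 by (auto simp: right_coideal_def)
qed


section \<open>Forms, bimodule morphisms and traces\<close>

lemma linear_to_dual_eq_0:
  assumes "linear_to_dual scale \<alpha>" and "inj \<alpha>" and "\<And>y. \<alpha> x y = 0"
  shows "x = 0"
proof -
  have "\<alpha> (scale 0 0) = (\<lambda>z. 0 * \<alpha> 0 z)"
    using assms(1) unfolding linear_to_dual_def by blast
  then have "\<alpha> x = \<alpha> 0" using assms(3) by (simp add: fun_eq_iff)
  then show ?thesis using assms(2) by (simp add: inj_eq)
qed

lemma circ_eq_left_act:
  assumes "inj \<alpha>" and "left_dual_hom scale \<Delta> \<alpha>"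
  shows "circ \<Delta> \<alpha> x y = \<alpha> x \<rightharpoonup> y"
proof -
  have "\<alpha> x \<star> \<alpha> y = \<alpha> (\<alpha> x \<rightharpoonup> y)"
    using assms(2) by (simp add: left_dual_hom_def linear_to_dual_def)
  then show ?thesis by (simp add: circ_def inv_f_f[OF assms(1)])
qed

text \<open>
  The product \<open>\<alpha> x \<star> \<alpha> y\<close> is the image of \<open>\<alpha> x \<rightharpoonup> y\<close> by left linearity and of \<open>x \<leftharpoonup> \<alpha> y\<close>
  by right linearity.  These elements therefore agree, and the counit sends them to \<open>\<alpha> x y\<close> and
  \<open>\<alpha> y x\<close>.
\<close>

lemma bimodule_hom_symmetric:
  assumes "inj \<alpha>" and "left_dual_hom scale \<Delta> \<alpha>" and "right_dual_hom scale \<Delta> \<alpha>"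
  shows "\<alpha> x y = \<alpha> y x"
proof -
  have dual: "\<alpha> z \<in> dual scale" for z
    using assms(2) by (simp add: left_dual_hom_def linear_to_dual_def)
  have "\<alpha> (\<alpha> x \<rightharpoonup> y) = \<alpha> (x \<leftharpoonup> \<alpha> y)"
    using assms(2,3) dual by (simp add: left_dual_hom_def right_dual_hom_def)
  then have "\<epsilon> (\<alpha> x \<rightharpoonup> y) = \<epsilon> (x \<leftharpoonup> \<alpha> y)"
    using \<open>inj \<alpha>\<close> by (simp add: inj_eq)
  then show ?thesis by (simp add: dual counit_left_act counit_right_act)
qed

lemma symmetric_coalgebra_form:
  assumes "symmetric_coalgebra scale \<Delta>"
  obtains B where "bilinear_form scale B" "symmetric_form B" "nondegenerate_form B"
    "balanced_form scale \<Delta> B"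
proof -
  obtain \<alpha> where \<alpha>: "inj \<alpha>" "left_dual_hom scale \<Delta> \<alpha>" "right_dual_hom scale \<Delta> \<alpha>"
    using assms by (auto simp: symmetric_coalgebra_def)
  have lin: "linear_to_dual scale \<alpha>"
    using \<alpha>(2) by (simp add: left_dual_hom_def)
  have dual: "\<alpha> x \<in> dual scale" for x using lin by (simp add: linear_to_dual_def)
  note sym = bimodule_hom_symmetric[OF \<alpha>]
  show thesis
  proof
    show "bilinear_form scale \<alpha>"
      using dual by (simp add: bilinear_form_def dual_def sym[of _ y for y])
    show "symmetric_form \<alpha>" using sym by (simp add: symmetric_form_def)
    show "nondegenerate_form \<alpha>"
      using linear_to_dual_eq_0[OF lin \<alpha>(1)] sym by (metis nondegenerate_form_def)
    show "balanced_form scale \<Delta> \<alpha>"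
      using \<alpha>(3) dual by (simp add: balanced_form_def right_dual_hom_def dual_left_act)
  qed
qed

text \<open>
  The bimodule morphism is \<open>x \<mapsto> B x\<close>.  Balancedness is its right linearity; exchanging the arguments
  of \<open>B\<close> turns balancedness into left linearity.
\<close>

lemma symmetric_coalgebraI_form:
  assumes bil: "bilinear_form scale B" and sym: "symmetric_form B" and nd: "nondegenerate_form B"
    and bal: "balanced_form scale \<Delta> B"
  shows "symmetric_coalgebra scale \<Delta>"
  unfolding symmetric_coalgebra_def
proof (intro exI conjI)
  have dual: "B x \<in> dual scale" for x
    using bil by (simp add: bilinear_form_def dual_def)
  have lin_left: "Vector_Spaces.linear scale (*) (\<lambda>x. B x y)" for y
    using bil by (simp add: bilinear_form_def)
  have lin: "linear_to_dual scale B"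
    using dual lin_left by (simp add: linear_to_dual_def Vector_Spaces.linear_iff fun_eq_iff)
  have balanced: "B (x \<leftharpoonup> c) y = B x (c \<rightharpoonup> y)" if "c \<in> dual scale" for x y c
    using bal that by (simp add: balanced_form_def)
  have comm: "B x y = B y x" for x y
    using sym by (simp add: symmetric_form_def)
  show "inj B"
  proof (rule injI)
    fix x y assume "B x = B y"
    then have "B (x - y) z = 0" for z
      using module_hom.diff[OF Vector_Spaces.linear.axioms(3)[OF lin_left], of x y z] by simp
    then have "x - y = 0" using nd unfolding nondegenerate_form_def by blast
    then show "x = y" by simp
  qed
  show "right_dual_hom scale \<Delta> B"
    using lin dual by (auto simp: right_dual_hom_def balanced dual_left_act fun_eq_iff)
  show "left_dual_hom scale \<Delta> B"
    unfolding left_dual_hom_def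
  proof (intro conjI ballI allI ext)
    fix c x y assume c: "c \<in> dual scale"
    have "B (c \<rightharpoonup> x) y = B x (y \<leftharpoonup> c)"
      using balanced[OF c] comm by metis
    then show "B (c \<rightharpoonup> x) y = (c \<star> B x) y" by (simp add: dual dual_right_act)
  qed (rule lin)
qed

text \<open>
  Here \<open>\<epsilon> (x \<circ> y) = \<epsilon> (\<alpha> x \<rightharpoonup> y) = \<alpha> x y\<close>, so the trace property of \<open>\<epsilon>\<close> is the symmetry of \<open>\<alpha>\<close>.
\<close>

lemma symmetric_coalgebra_counit_trace:
  assumes "symmetric_coalgebra scale \<Delta>"
  obtains \<alpha> where "inj \<alpha>" "left_dual_hom scale \<Delta> \<alpha>"
    and "\<And>x y. \<epsilon> (circ \<Delta> \<alpha> x y) = \<epsilon> (circ \<Delta> \<alpha> y x)"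
proof -
  obtain \<alpha> where \<alpha>: "inj \<alpha>" "left_dual_hom scale \<Delta> \<alpha>" "right_dual_hom scale \<Delta> \<alpha>"
    using assms by (auto simp: symmetric_coalgebra_def)
  have dual: "\<alpha> x \<in> dual scale" for x
    using \<alpha>(2) by (simp add: left_dual_hom_def linear_to_dual_def)
  show thesis
    using \<alpha> bimodule_hom_symmetric[OF \<alpha>] dual
    by (intro that[of \<alpha>]) (simp_all add: circ_eq_left_act counit_left_act)
qed

text \<open>
  The form \<open>B x y = f (x \<circ> y)\<close> satisfies the hypotheses of \<open>symmetric_coalgebraI_form\<close>.
  Its non-degeneracy uses coideals inside the product of the radical with \<open>C\<close>, on which \<open>f\<close>
  vanishes by definition of the radical.
\<close>

lemma symmetric_coalgebraI_trace:
  assumes inj: "inj \<alpha>" and hom: "left_dual_hom scale \<Delta> \<alpha>"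
    and f: "Vector_Spaces.linear scale (*) f"
    and circ_trace: "\<And>x y. f (circ \<Delta> \<alpha> x y) = f (circ \<Delta> \<alpha> y x)"
    and act_trace: "\<And>x c. c \<in> dual scale \<Longrightarrow> f (c \<rightharpoonup> x) = f (x \<leftharpoonup> c)"
    and no_coideal:
      "(\<forall>I. left_coideal scale \<Delta> I \<longrightarrow> I \<subseteq> {x. f x = 0} \<longrightarrow> I = {0}) \<or>
       (\<forall>I. right_coideal scale \<Delta> I \<longrightarrow> I \<subseteq> {x. f x = 0} \<longrightarrow> I = {0})"
  shows "symmetric_coalgebra scale \<Delta>"
proof -
  have lin: "linear_to_dual scale \<alpha>"
    using hom by (simp add: left_dual_hom_def)
  have dual: "\<alpha> x \<in> dual scale" for x using lin by (simp add: linear_to_dual_def)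
  have hom_act: "\<alpha> (c \<rightharpoonup> x) = c \<star> \<alpha> x" if "c \<in> dual scale" for c x
    using hom that by (simp add: left_dual_hom_def)
  define B where "B x y = f (\<alpha> x \<rightharpoonup> y)" for x y
  have act_add: "\<alpha> (x + y) \<rightharpoonup> z = (\<alpha> x \<rightharpoonup> z) + (\<alpha> y \<rightharpoonup> z)"
    and act_scale: "\<alpha> (scale a x) \<rightharpoonup> z = scale a (\<alpha> x \<rightharpoonup> z)" for x y z a
    using lin by (simp_all add: linear_to_dual_def left_act_add_dual left_act_scale_dual)
  \<comment> \<open>Bilinearity: \<open>\<alpha> x \<rightharpoonup> z\<close> is also linear in \<open>x\<close>.\<close>
  have lin_orbit: "Vector_Spaces.linear scale scale (\<lambda>x. \<alpha> x \<rightharpoonup> z)" for z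
    by (simp add: Vector_Spaces.linear_iff vector_space_axioms act_add act_scale)
  have bil: "bilinear_form scale B"
    using Vector_Spaces.linear_compose[OF linear_left_act[OF dual] f]
      Vector_Spaces.linear_compose[OF lin_orbit f]
    by (simp add: bilinear_form_def B_def o_def)
  have comm: "B x y = B y x" for x y
    using circ_trace[of x y] by (simp add: B_def circ_eq_left_act[OF inj hom])
  \<comment> \<open>The second trace property carries \<open>c\<close> around the product, from the left of \<open>x\<close> to the right
    of \<open>y\<close>.\<close>
  have shift: "B (c \<rightharpoonup> x) y = B x (y \<leftharpoonup> c)" if c: "c \<in> dual scale" for c x y
  proof -
    have "B (c \<rightharpoonup> x) y = f (c \<rightharpoonup> (\<alpha> x \<rightharpoonup> y))"
      by (simp add: B_def hom_act c left_act_convolution dual)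
    also have "\<dots> = f ((\<alpha> x \<rightharpoonup> y) \<leftharpoonup> c)" by (rule act_trace[OF c])
    also have "\<dots> = B x (y \<leftharpoonup> c)" by (simp add: B_def left_act_right_act dual c)
    finally show ?thesis .
  qed
  have B_dual: "(\<lambda>x. B x y) \<in> dual scale" for y
    using bil by (simp add: bilinear_form_def dual_def)
  have bal: "balanced_form scale \<Delta> B"
    using shift comm by (metis balanced_form_def)
  have zero: "x = 0" if x: "\<And>y. B x y = 0" for x
  proof -
    have "\<alpha> x \<rightharpoonup> y = 0" for y
      using no_coideal
    proof
      assume left: "\<forall>I. left_coideal scale \<Delta> I \<longrightarrow> I \<subseteq> {x. f x = 0} \<longrightarrow> I = {0}"
      interpret A: Vector_Spaces.linear scale scale "\<lambda>y. \<alpha> x \<rightharpoonup> y"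
        by (rule linear_left_act[OF dual])
      \<comment> \<open>Already the orbit of the single radical element \<open>x\<close> is a right submodule.\<close>
      let ?I = "range (\<lambda>y. \<alpha> x \<rightharpoonup> y)"
      have "left_coideal scale \<Delta> ?I"
        by (rule left_coidealI) (auto simp: A.subspace_image left_act_right_act dual)
      moreover have "?I \<subseteq> {x. f x = 0}"
        using x by (auto simp: B_def)
      ultimately show ?thesis using left by blast
    next
      assume right: "\<forall>I. right_coideal scale \<Delta> I \<longrightarrow> I \<subseteq> {x. f x = 0} \<longrightarrow> I = {0}"
      interpret A: Vector_Spaces.linear scale scale "\<lambda>x. \<alpha> x \<rightharpoonup> y" by (rule lin_orbit)
      \<comment> \<open>Left multiplication changes \<open>x\<close>, so here the whole radical is needed; \<open>y\<close> stays fixed.\<close>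
      define J where "J = {x. \<forall>y. B x y = 0}"
      have "subspace J"
        using dual_add[OF B_dual] dual_scale[OF B_dual] dual_zero[OF B_dual]
        by (simp add: J_def subspace_def)
      moreover have "c \<rightharpoonup> (\<alpha> x \<rightharpoonup> y) \<in> (\<lambda>x. \<alpha> x \<rightharpoonup> y) ` J" if "x \<in> J" "c \<in> dual scale" for c x
      proof -
        have "c \<rightharpoonup> x \<in> J" using that by (simp add: J_def shift)
        moreover have "c \<rightharpoonup> (\<alpha> x \<rightharpoonup> y) = \<alpha> (c \<rightharpoonup> x) \<rightharpoonup> y"
          using that by (simp add: hom_act left_act_convolution dual)
        ultimately show ?thesis by blast
      qed
      ultimately have "right_coideal scale \<Delta> ((\<lambda>x. \<alpha> x \<rightharpoonup> y) ` J)"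
        by (intro right_coidealI) (auto simp: A.subspace_image)
      moreover have "(\<lambda>x. \<alpha> x \<rightharpoonup> y) ` J \<subseteq> {x. f x = 0}"
        by (auto simp: B_def J_def)
      ultimately have "(\<lambda>x. \<alpha> x \<rightharpoonup> y) ` J = {0}" using right by blast
      moreover have "x \<in> J" using x by (simp add: J_def)
      ultimately show ?thesis by blast
    qed
    then have "\<epsilon> (\<alpha> x \<rightharpoonup> y) = \<epsilon> 0" for y by simp
    then have "\<alpha> x y = 0" for y
      by (simp add: counit_left_act dual dual_zero[OF counit_dual])
    then show "x = 0" by (rule linear_to_dual_eq_0[OF lin inj])
  qed
  show ?thesis
  proof (rule symmetric_coalgebraI_form[OF bil _ _ bal])
    show "symmetric_form B" using comm by (simp add: symmetric_form_def)
    show "nondegenerate_form B" using zero comm by (metis nondegenerate_form_def)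
  qed
qed

end

theorem theorem4p3:
  fixes scale :: "'k::field \<Rightarrow> 'c::ab_group_add \<Rightarrow> 'c"
    and \<Delta> :: "'c \<Rightarrow> ('c \<times> 'c \<Rightarrow>\<^sub>0 'k) set"
    and \<epsilon> :: "'c \<Rightarrow> 'k"
  assumes "coalgebra scale \<Delta> \<epsilon>"
  shows
    "(symmetric_coalgebra scale \<Delta> \<longleftrightarrow>
        (\<exists>B. bilinear_form scale B \<and> symmetric_form B \<and> nondegenerate_form B \<and> balanced_form scale \<Delta> B))
   \<and> (symmetric_coalgebra scale \<Delta> \<longleftrightarrow>
        co_Frobenius scale \<Delta> \<and>
        (\<exists>\<alpha> f. inj \<alpha> \<and> left_dual_hom scale \<Delta> \<alpha> \<and> Vector_Spaces.linear scale (*) f \<and>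
           (\<forall>x y. f (circ \<Delta> \<alpha> x y) = f (circ \<Delta> \<alpha> y x)) \<and>
           (\<forall>x. \<forall>c \<in> dual scale. f (left_act scale \<Delta> c x) = f (right_act scale \<Delta> x c)) \<and>
           \<not> (\<exists>I. left_coideal scale \<Delta> I \<and> I \<noteq> {0} \<and> I \<subseteq> {x. f x = 0})))
   \<and> (symmetric_coalgebra scale \<Delta> \<longleftrightarrow>
        co_Frobenius scale \<Delta> \<and>
        (\<exists>\<alpha> f. inj \<alpha> \<and> left_dual_hom scale \<Delta> \<alpha> \<and> Vector_Spaces.linear scale (*) f \<and>
           (\<forall>x y. f (circ \<Delta> \<alpha> x y) = f (circ \<Delta> \<alpha> y x)) \<and>
           (\<forall>x. \<forall>c \<in> dual scale. f (left_act scale \<Delta> c x) = f (right_act scale \<Delta> x c)) \<and>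
           \<not> (\<exists>I. right_coideal scale \<Delta> I \<and> I \<noteq> {0} \<and> I \<subseteq> {x. f x = 0})))"
proof -
  interpret coalgebra scale \<Delta> \<epsilon> by fact
  have coFrob: "symmetric_coalgebra scale \<Delta> \<Longrightarrow> co_Frobenius scale \<Delta>"
    by (auto simp: symmetric_coalgebra_def co_Frobenius_def left_co_Frobenius_def
        right_co_Frobenius_def)
  have counit_trace: "\<epsilon> (left_act scale \<Delta> c x) = \<epsilon> (right_act scale \<Delta> x c)"
    if "c \<in> dual scale" for c x
    using that by (simp add: counit_left_act counit_right_act)
  show ?thesis (is "(?S \<longleftrightarrow> ?B) \<and> (?S \<longleftrightarrow> ?L) \<and> (?S \<longleftrightarrow> ?R)")
  proof -
    have B: "?S \<longleftrightarrow> ?B"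
      using symmetric_coalgebra_form symmetric_coalgebraI_form by metis
    have "?L" "?R" if S: "?S"
    proof -
      obtain \<alpha> where "inj \<alpha>" "left_dual_hom scale \<Delta> \<alpha>"
        "\<forall>x y. \<epsilon> (circ \<Delta> \<alpha> x y) = \<epsilon> (circ \<Delta> \<alpha> y x)"
        using symmetric_coalgebra_counit_trace[OF S] by metis
      then show "?L" "?R"
        using coFrob[OF S] counit_linear counit_trace
          left_coideal_counit_zero right_coideal_counit_zero by blast+
    qed
    moreover have "?S" if "?L"
      using that by (elim conjE exE) (rule symmetric_coalgebraI_trace, assumption+, blast+)
    moreover have "?S" if "?R"
      using that by (elim conjE exE) (rule symmetric_coalgebraI_trace, assumption+, blast+)
    ultimately show ?thesis using B by argo
  qed
qed

end
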